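(* Let $(X,\mathcal{B})$ be a bornological universe where $X$ is a Tychonoff space. Then $(X,\mathcal{B})$ is realcompact if and only if each character on $\mathcal{C}_{\mathcal{B}}(X)$ is equal to a point-evaluation, i.e. for each character $\tau$ on $\mathcal{C}_{\mathcal{B}}(X)$ there is an $x\in X$ such that $\tau(f)=f(x)$ for all $f\in\mathcal{C}_{\mathcal{B}}(X)$.
   Context: A bornology on a set $X$ is a set $\mathcal{B}\subseteq 2^X$ such that $\{x\}\in\mathcal{B}$ for each $x\in X$; $B\in\mathcal{B}$ and $A\subseteq B$ imply $A\in\mathcal{B}$; and $A\cup B\in\mathcal{B}$ whenever $A,B\in\mathcal{B}$. A bornological universe $(X,\mathcal{B})$ is a topological space $X$ endowed with a bornology $\mathcal{B}$ on its underlying set. Tychonoff means completely regular and Hausdorff. $\mathcal{C}_{\mathcal{B}}(X)$ is the real algebra (with pointwise operations) of all continuous real valued maps on $X$ that are bounded on every element of $\mathcal{B}$. A character on an algebra is a non-zero, real valued algebra morphism. For $X$ Tychonoff and a continuous $f:X\to\mathbb{R}$, $f^{\beta}$ denotes the unique continuous map from the Stone–Čech compactification $\beta(X)$ to the one-point compactification $\mathbb{R}\cup\{\infty\}$ whose restriction to $X$ is $f$. Put $\upsilon_{\mathcal{B}}(X)=\{x\in\beta(X)\mid \forall f\in\mathcal{C}_{\mathcal{B}}(X): f^{\beta}(x)\neq\infty\}$, a subspace of $\beta(X)$ containing $X$. $(X,\mathcal{B})$ is realcompact if $\upsilon_{\mathcal{B}}(X)=X$. *)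

theory Defs
  imports "HOL-Analysis.Analysis"
begin

section \<open>Bornological universes\<close>

definition bornology_on :: "'a set \<Rightarrow> 'a set set \<Rightarrow> bool" where
  "bornology_on S \<B> \<longleftrightarrow>
     \<B> \<subseteq> Pow S \<and>
     (\<forall>x\<in>S. {x} \<in> \<B>) \<and>
     (\<forall>A B. B \<in> \<B> \<and> A \<subseteq> B \<longrightarrow> A \<in> \<B>) \<and>
     (\<forall>A\<in>\<B>. \<forall>B\<in>\<B>. A \<union> B \<in> \<B>)"

definition bornological_universe :: "'a topology \<Rightarrow> 'a set set \<Rightarrow> bool" where
  "bornological_universe X \<B> \<longleftrightarrow> bornology_on (topspace X) \<B>"

definition Tychonoff_space :: "'a topology \<Rightarrow> bool" where
  "Tychonoff_space X \<longleftrightarrow> completely_regular_space X \<and> Hausdorff_space X"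


section \<open>The algebra of continuous functions bounded on a bornology\<close>

text \<open>A real-valued map on a set \<open>S\<close> is represented by the unique HOL function that agrees
  with it on \<open>S\<close> and is \<open>undefined\<close> elsewhere (\<^const>\<open>extensional\<close>). Accordingly the pointwise
  operations are restricted to \<open>S\<close>. Without this, a function's values outside \<open>S\<close> would be
  visible to characters.\<close>

definition bounded_cfuns :: "'a topology \<Rightarrow> 'a set set \<Rightarrow> ('a \<Rightarrow> real) set" where
  "bounded_cfuns X \<B> =
     {f \<in> extensional (topspace X).
        continuous_map X euclideanreal f \<and> (\<forall>B\<in>\<B>. bounded (f ` B))}"

definition fun_add :: "'a set \<Rightarrow> ('a \<Rightarrow> real) \<Rightarrow> ('a \<Rightarrow> real) \<Rightarrow> 'a \<Rightarrow> real" where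
  "fun_add S f g = (\<lambda>x\<in>S. f x + g x)"

definition fun_mult :: "'a set \<Rightarrow> ('a \<Rightarrow> real) \<Rightarrow> ('a \<Rightarrow> real) \<Rightarrow> 'a \<Rightarrow> real" where
  "fun_mult S f g = (\<lambda>x\<in>S. f x * g x)"

definition fun_scale :: "'a set \<Rightarrow> real \<Rightarrow> ('a \<Rightarrow> real) \<Rightarrow> 'a \<Rightarrow> real" where
  "fun_scale S c f = (\<lambda>x\<in>S. c * f x)"

text \<open>Only the values of \<open>\<tau>\<close> on \<open>\<A>\<close> are constrained. Multiplicativity and non-triviality
  already force a unit to be sent to \<open>1\<close>.\<close>

definition character_on :: "'a set \<Rightarrow> ('a \<Rightarrow> real) set \<Rightarrow> (('a \<Rightarrow> real) \<Rightarrow> real) \<Rightarrow> bool" where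
  "character_on S \<A> \<tau> \<longleftrightarrow>
     (\<forall>f\<in>\<A>. \<forall>g\<in>\<A>. \<tau> (fun_add S f g) = \<tau> f + \<tau> g) \<and>
     (\<forall>c. \<forall>f\<in>\<A>. \<tau> (fun_scale S c f) = c * \<tau> f) \<and>
     (\<forall>f\<in>\<A>. \<forall>g\<in>\<A>. \<tau> (fun_mult S f g) = \<tau> f * \<tau> g) \<and>
     (\<exists>f\<in>\<A>. \<tau> f \<noteq> 0)"

lemma bounded_cfuns_algebra:
  assumes "f \<in> bounded_cfuns X \<B>" "g \<in> bounded_cfuns X \<B>" "\<B> \<subseteq> Pow (topspace X)"
  shows "fun_add (topspace X) f g \<in> bounded_cfuns X \<B>"
    and "fun_mult (topspace X) f g \<in> bounded_cfuns X \<B>"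
    and "fun_scale (topspace X) c f \<in> bounded_cfuns X \<B>"
    and "(\<lambda>x\<in>topspace X. c) \<in> bounded_cfuns X \<B>"
proof -
  have restr: "(\<lambda>x\<in>topspace X. h x) \<in> bounded_cfuns X \<B>"
    if "continuous_map X euclideanreal h" "\<And>B. B \<in> \<B> \<Longrightarrow> bounded (h ` B)" for h
  proof -
    have "(\<lambda>x\<in>topspace X. h x) ` B = h ` B" if "B \<in> \<B>" for B
      using that assms(3) by (intro image_cong) auto
    moreover have "continuous_map X euclideanreal (\<lambda>x\<in>topspace X. h x)"
      using that(1) by (rule continuous_map_eq) auto
    ultimately show ?thesis
      using that(2) by (simp add: bounded_cfuns_def)
  qed
  have f: "continuous_map X euclideanreal f" "\<And>B. B \<in> \<B> \<Longrightarrow> bounded (f ` B)"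
   and g: "continuous_map X euclideanreal g" "\<And>B. B \<in> \<B> \<Longrightarrow> bounded (g ` B)"
    using assms by (auto simp: bounded_cfuns_def)
  have mult: "bounded ((\<lambda>x. u x * v x) ` B)"
    if uv: "bounded (u ` B)" "bounded (v ` B)" for u v :: "'a \<Rightarrow> real" and B
  proof -
    obtain a where a: "\<And>x. x \<in> B \<Longrightarrow> \<bar>u x\<bar> \<le> a" using uv(1) by (auto simp: bounded_iff)
    obtain b where b: "\<And>x. x \<in> B \<Longrightarrow> \<bar>v x\<bar> \<le> b" using uv(2) by (auto simp: bounded_iff)
    have "\<bar>u x * v x\<bar> \<le> a * b" if "x \<in> B" for x
      unfolding abs_mult using a[OF that] b[OF that] by (intro mult_mono) auto
    then show ?thesis by (auto simp: bounded_iff)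
  qed
  show "fun_add (topspace X) f g \<in> bounded_cfuns X \<B>"
    unfolding fun_add_def using f g by (intro restr continuous_intros bounded_plus_comp) auto
  show "fun_mult (topspace X) f g \<in> bounded_cfuns X \<B>"
    unfolding fun_mult_def using f g by (intro restr mult continuous_map_real_mult) auto
  show "fun_scale (topspace X) c f \<in> bounded_cfuns X \<B>"
    unfolding fun_scale_def using f
    by (intro restr mult continuous_map_real_mult) (auto simp: bounded_iff)
  show "(\<lambda>x\<in>topspace X. c) \<in> bounded_cfuns X \<B>"
    by (intro restr) (auto simp: bounded_iff)
qed


section \<open>The Stone--Cech compactification\<close>

text \<open>\<open>\<beta>(X)\<close> is the closure of the image of \<open>X\<close> under the evaluation map into the cube
  indexed by all continuous maps from \<open>X\<close> to the unit interval.\<close>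

definition unit_cfuns :: "'a topology \<Rightarrow> ('a \<Rightarrow> real) set" where
  "unit_cfuns X = {h \<in> extensional (topspace X). continuous_map X (top_of_set {0..1}) h}"

definition unit_cube :: "'a topology \<Rightarrow> (('a \<Rightarrow> real) \<Rightarrow> real) topology" where
  "unit_cube X = product_topology (\<lambda>h. top_of_set {0..1}) (unit_cfuns X)"

definition stone_cech_embed :: "'a topology \<Rightarrow> 'a \<Rightarrow> ('a \<Rightarrow> real) \<Rightarrow> real" where
  "stone_cech_embed X x = (\<lambda>h\<in>unit_cfuns X. h x)"

definition stone_cech :: "'a topology \<Rightarrow> (('a \<Rightarrow> real) \<Rightarrow> real) topology" where
  "stone_cech X =
     subtopology (unit_cube X) (unit_cube X closure_of (stone_cech_embed X ` topspace X))"

text \<open>The extension \<open>f\<^sup>\<beta>\<close> of a real-valued \<open>f\<close>. The target \<open>\<real> \<union> {\<infinity>}\<close> has \<^const>\<open>None\<close> as the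
  point at infinity; existence and uniqueness are shown in \<open>stone_cech_ext_unique\<close> below.\<close>

definition is_stone_cech_ext ::
    "'a topology \<Rightarrow> ('a \<Rightarrow> real) \<Rightarrow> ((('a \<Rightarrow> real) \<Rightarrow> real) \<Rightarrow> real option) \<Rightarrow> bool" where
  "is_stone_cech_ext X f g \<longleftrightarrow>
     g \<in> extensional (topspace (stone_cech X)) \<and>
     continuous_map (stone_cech X) (Alexandroff_compactification euclideanreal) g \<and>
     (\<forall>x\<in>topspace X. g (stone_cech_embed X x) = Some (f x))"

definition stone_cech_ext :: "'a topology \<Rightarrow> ('a \<Rightarrow> real) \<Rightarrow> (('a \<Rightarrow> real) \<Rightarrow> real) \<Rightarrow> real option" where
  "stone_cech_ext X f = (THE g. is_stone_cech_ext X f g)"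

lemma unit_cfuns_eq:
  "unit_cfuns X =
     mspace (submetric (cfunspace X euclidean_metric) {f. f \<in> topspace X \<rightarrow> {0..1}})"
proof -
  have "bounded (f ` topspace X)" if "f \<in> topspace X \<rightarrow> {0..1}" for f :: "'a \<Rightarrow> real"
    by (rule bounded_subset[OF bounded_closed_interval[of 0 1]]) (use that in auto)
  then show ?thesis
    by (auto simp: unit_cfuns_def continuous_map_in_subtopology Pi_iff image_subset_iff)
qed

lemma embedding_map_stone_cech_embed_cube:
  assumes "Tychonoff_space X"
  shows "embedding_map X (unit_cube X) (stone_cech_embed X)"
proof -
  have "stone_cech_embed X = (\<lambda>x. \<lambda>h\<in>unit_cfuns X. h x)"
    by (simp add: stone_cech_embed_def fun_eq_iff)
  then show ?thesis
    using completely_regular_space_cube_embedding_explicit[of X] assms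
    unfolding unit_cube_def Tychonoff_space_def unit_cfuns_eq by simp
qed

lemma continuous_map_stone_cech_embed_cube:
  "continuous_map X (unit_cube X) (stone_cech_embed X)"
  by (auto simp: unit_cube_def stone_cech_embed_def continuous_map_componentwise unit_cfuns_def)

lemma compact_Hausdorff_unit_cube: "compact_space (unit_cube X)" "Hausdorff_space (unit_cube X)"
  by (auto simp: unit_cube_def compact_space_product_topology Hausdorff_space_product_topology
      Hausdorff_space_subtopology compact_space_subtopology)

lemma stone_cech_embed_subset_closure:
  "stone_cech_embed X ` topspace X \<subseteq> unit_cube X closure_of (stone_cech_embed X ` topspace X)"
  by (metis closure_of_subset continuous_map_image_subset_topspace continuous_map_stone_cech_embed_cube)

lemma topspace_stone_cech:
  "topspace (stone_cech X) = unit_cube X closure_of (stone_cech_embed X ` topspace X)"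
  by (simp add: stone_cech_def closure_of_subset_topspace inf.absorb2)

lemma compact_Hausdorff_stone_cech:
  "compact_space (stone_cech X)" "Hausdorff_space (stone_cech X)"
  unfolding stone_cech_def
  by (intro compact_space_subtopology closedin_compact_space compact_Hausdorff_unit_cube
        closedin_closure_of Hausdorff_space_subtopology)+

lemma embedding_map_stone_cech_embed:
  assumes "Tychonoff_space X"
  shows "embedding_map X (stone_cech X) (stone_cech_embed X)"
  using embedding_map_stone_cech_embed_cube[OF assms] stone_cech_embed_subset_closure
  by (simp add: stone_cech_def embedding_map_in_subtopology)

lemma stone_cech_dense:
  "stone_cech X closure_of (stone_cech_embed X ` topspace X) = topspace (stone_cech X)"
proof -
  let ?C = "unit_cube X closure_of (stone_cech_embed X ` topspace X)"
  have "?C \<inter> stone_cech_embed X ` topspace X = stone_cech_embed X ` topspace X"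
    using stone_cech_embed_subset_closure[of X] by (rule inf.absorb2)
  then show ?thesis
    unfolding topspace_stone_cech unfolding stone_cech_def closure_of_subtopology by (metis inf.idem)
qed

lemma stone_cech_extension_exists:
  assumes f: "continuous_map X Y f" and Y: "compact_space Y" "Hausdorff_space Y"
  obtains g where "continuous_map (stone_cech X) Y g"
    and "\<And>x. x \<in> topspace X \<Longrightarrow> g (stone_cech_embed X x) = f x"
proof -
  have "Tychonoff_space Y"
    using Y by (auto simp: Tychonoff_space_def compact_Hausdorff_imp_regular_space
        completely_regular_eq_regular_space compact_imp_locally_compact_space)
  then have emb: "embedding_map Y (unit_cube Y) (stone_cech_embed Y)"
    by (rule embedding_map_stone_cech_embed_cube)
  let ?S = "stone_cech_embed Y ` topspace Y"
  obtain r where r: "continuous_map (subtopology (unit_cube Y) ?S) Y r"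
    "\<And>y. y \<in> topspace Y \<Longrightarrow> r (stone_cech_embed Y y) = y"
    using emb by (auto simp: embedding_map_def homeomorphic_map_maps homeomorphic_maps_def)
  define \<Phi> where "\<Phi> = (\<lambda>p. \<lambda>j\<in>unit_cfuns Y. p (restrict (j \<circ> f) (topspace X)) :: real)"
  have pull: "restrict (j \<circ> f) (topspace X) \<in> unit_cfuns X" if "j \<in> unit_cfuns Y" for j
  proof -
    have "continuous_map X (top_of_set {0..1}) (j \<circ> f)"
      using that f by (auto simp: unit_cfuns_def intro: continuous_map_compose)
    then have "continuous_map X (top_of_set {0..1}) (restrict (j \<circ> f) (topspace X))"
      by (rule continuous_map_eq) auto
    then show ?thesis by (simp add: unit_cfuns_def)
  qed
  have \<Phi>: "continuous_map (unit_cube X) (unit_cube Y) \<Phi>"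
    unfolding unit_cube_def \<Phi>_def
    using pull by (auto simp: continuous_map_componentwise
        intro!: continuous_map_product_projection)
  have \<Phi>e: "\<Phi> (stone_cech_embed X x) = stone_cech_embed Y (f x)" if "x \<in> topspace X" for x
    using that pull by (auto simp: \<Phi>_def stone_cech_embed_def fun_eq_iff)
  have closed: "closedin (unit_cube Y) ?S"
    using Y(1) compact_Hausdorff_unit_cube(2) continuous_map_stone_cech_embed_cube
    by (metis compactin_imp_closedin compact_space_def image_compactin)
  have "\<Phi> ` (unit_cube X closure_of (stone_cech_embed X ` topspace X)) \<subseteq>
        unit_cube Y closure_of (\<Phi> ` (stone_cech_embed X ` topspace X))"
    by (rule continuous_map_image_closure_subset[OF \<Phi>])
  also have "\<dots> \<subseteq> ?S"
    using f by (intro closure_of_minimal closed) (auto simp: \<Phi>e continuous_map_def)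
  finally have "continuous_map (stone_cech X) (subtopology (unit_cube Y) ?S) \<Phi>"
    using \<Phi> by (auto simp: stone_cech_def continuous_map_in_subtopology
        continuous_map_from_subtopology)
  then have "continuous_map (stone_cech X) Y (r \<circ> \<Phi>)"
    using r(1) by (rule continuous_map_compose)
  moreover have "(r \<circ> \<Phi>) (stone_cech_embed X x) = f x" if "x \<in> topspace X" for x
    using that f r(2) \<Phi>e by (auto simp: continuous_map_def)
  ultimately show thesis by (rule that)
qed

lemma stone_cech_ext_unique:
  assumes "continuous_map X euclideanreal f"
  shows "\<exists>!g. is_stone_cech_ext X f g"
proof -
  let ?A = "Alexandroff_compactification euclideanreal"
  have haus: "Hausdorff_space ?A"
    by (simp add: Hausdorff_space_Alexandroff_compactification locally_compact_space_euclidean)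
  have "continuous_map X ?A (Some \<circ> f)"
    using assms continuous_map_Some by (rule continuous_map_compose)
  then obtain g where g: "continuous_map (stone_cech X) ?A g"
    "\<And>x. x \<in> topspace X \<Longrightarrow> g (stone_cech_embed X x) = (Some \<circ> f) x"
    using stone_cech_extension_exists[OF _ compact_space_Alexandroff_compactification haus] by metis
  have "continuous_map (stone_cech X) ?A (restrict g (topspace (stone_cech X)))"
    using g(1) by (rule continuous_map_eq) auto
  then have "is_stone_cech_ext X f (restrict g (topspace (stone_cech X)))"
    using g(2) stone_cech_embed_subset_closure[of X]
    by (auto simp: is_stone_cech_ext_def topspace_stone_cech)
  moreover have "u = v" if "is_stone_cech_ext X f u" "is_stone_cech_ext X f v" for u v
  proof (rule extensionalityI)
    fix p assume "p \<in> topspace (stone_cech X)"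
    then have p: "p \<in> stone_cech X closure_of (stone_cech_embed X ` topspace X)"
      by (simp add: stone_cech_dense)
    have u: "continuous_map (stone_cech X) ?A u" and v: "continuous_map (stone_cech X) ?A v"
      using that by (simp_all add: is_stone_cech_ext_def)
    show "u p = v p"
      by (rule forall_in_closure_of_eq[OF p haus u v]) (use that in \<open>auto simp: is_stone_cech_ext_def\<close>)
  next
    show "u \<in> extensional (topspace (stone_cech X))" "v \<in> extensional (topspace (stone_cech X))"
      using that by (simp_all add: is_stone_cech_ext_def)
  qed
  ultimately show ?thesis by blast
qed

lemma is_stone_cech_ext:
  assumes "continuous_map X euclideanreal f"
  shows "is_stone_cech_ext X f (stone_cech_ext X f)"
  unfolding stone_cech_ext_def by (rule theI'[OF stone_cech_ext_unique[OF assms]])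


section \<open>Realcompactness\<close>

definition realcompactification ::
    "'a topology \<Rightarrow> 'a set set \<Rightarrow> (('a \<Rightarrow> real) \<Rightarrow> real) set" where
  "realcompactification X \<B> =
     {p \<in> topspace (stone_cech X). \<forall>f\<in>bounded_cfuns X \<B>. stone_cech_ext X f p \<noteq> None}"

text \<open>\<open>X\<close> is identified with its image in \<open>\<beta>(X)\<close>.\<close>

definition realcompact_universe :: "'a topology \<Rightarrow> 'a set set \<Rightarrow> bool" where
  "realcompact_universe X \<B> \<longleftrightarrow> realcompactification X \<B> = stone_cech_embed X ` topspace X"

end

theory Submission
  imports Defs
begin

text \<open>
  The proof passes through proper filters on \<open>X\<close>. Call such a filter \<open>F\<close> adapted to the algebra
  \<open>\<A> = bounded_cfuns X \<B>\<close> if every \<open>f \<in> \<A>\<close> has a finite limit along \<open>F\<close>. Adapted filters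
  mediate between the two sides of the equivalence:

  \<^item> Characters are exactly the maps \<open>f \<mapsto> lim\<^sub>F f\<close> for adapted \<open>F\<close>. Limits are additive and
    multiplicative (\<open>limit_along_filter_is_character\<close>). Conversely, no function in the kernel
    of a character is bounded away from \<open>0\<close>, for its reciprocal would then again lie in \<open>\<A>\<close>;
    hence the sets \<open>{x. \<bar>g x\<bar> < 1}\<close> with \<open>g\<close> in the kernel are a base of a proper filter, and every
    \<open>f \<in> \<A>\<close> tends along it to its value under the character (\<open>character_is_limit_along_filter\<close>).

  \<^item> The points of \<open>\<upsilon>\<^sub>\<B>(X)\<close> are exactly the limits in \<open>\<beta>(X)\<close> of adapted filters: if \<open>F\<close> converges to
    \<open>p\<close>, then \<open>f\<^sup>\<beta>(p)\<close> is the limit of \<open>f\<close> along \<open>F\<close>, taken in \<open>\<real> \<union> {\<infinity>}\<close>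
    (\<open>stone_cech_ext_eq_Some_iff\<close>).

  Thus characters and points of \<open>\<upsilon>\<^sub>\<B>(X)\<close> correspond via \<open>\<tau>(f) = f\<^sup>\<beta>(p)\<close>. As \<open>\<A>\<close> contains all
  continuous maps into the unit interval, which are the coordinates of \<open>\<beta>(X)\<close>, the character
  determines \<open>p\<close>; so \<open>\<tau>\<close> is the evaluation at \<open>x \<in> X\<close> precisely when \<open>p\<close> is the image of \<open>x\<close>.
\<close>

section \<open>Closure points as filter limits\<close>

text \<open>Density of \<open>X\<close> in \<open>\<beta>(X)\<close> enters through this lemma: the neighbourhood
  filter of a closure point pulls back along \<open>e\<close> to a proper filter on \<open>S\<close>.\<close>

lemma closure_of_image_imp_limitin:
  assumes "p \<in> Y closure_of (e ` S)"
  obtains F where "F \<noteq> bot" "F \<le> principal S" "limitin Y e p F"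
proof
  let ?F = "inf (filtercomap e (nhdsin Y p)) (principal S)"
  have p: "p \<in> topspace Y" and meets: "\<And>U. p \<in> U \<Longrightarrow> openin Y U \<Longrightarrow> \<exists>x\<in>S. e x \<in> U"
    using assms by (auto simp: in_closure_of)
  have ev: "eventually P ?F \<longleftrightarrow> (\<exists>U. openin Y U \<and> p \<in> U \<and> (\<forall>x\<in>S. e x \<in> U \<longrightarrow> P x))" for P
  proof -
    have "eventually P ?F \<longleftrightarrow> (\<exists>Q. (\<exists>U. openin Y U \<and> p \<in> U \<and> (\<forall>y\<in>U. Q y)) \<and>
        (\<forall>x. Q (e x) \<longrightarrow> x \<in> S \<longrightarrow> P x))"
      using p by (simp add: eventually_inf_principal eventually_filtercomap eventually_nhdsin)
    also have "\<dots> \<longleftrightarrow> (\<exists>U. openin Y U \<and> p \<in> U \<and> (\<forall>x\<in>S. e x \<in> U \<longrightarrow> P x))"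
    proof
      assume "\<exists>U. openin Y U \<and> p \<in> U \<and> (\<forall>x\<in>S. e x \<in> U \<longrightarrow> P x)"
      then obtain U where "openin Y U" "p \<in> U" "\<forall>x\<in>S. e x \<in> U \<longrightarrow> P x"
        by blast
      then show "\<exists>Q. (\<exists>U. openin Y U \<and> p \<in> U \<and> (\<forall>y\<in>U. Q y)) \<and>
          (\<forall>x. Q (e x) \<longrightarrow> x \<in> S \<longrightarrow> P x)"
        by (intro exI[of _ "\<lambda>y. y \<in> U"]) auto
    qed metis
    finally show ?thesis .
  qed
  show "?F \<noteq> bot"
    unfolding trivial_limit_def ev using meets by blast
  show "?F \<le> principal S"
    by simp
  show "limitin Y e p ?F"
    using p by (auto simp: limitin_def ev)
qed

lemma limitin_imp_closure_of:
  assumes "limitin Y e p F" "F \<noteq> bot" "F \<le> principal S"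
  shows "p \<in> Y closure_of (e ` S)"
  unfolding in_closure_of
proof (intro conjI allI impI)
  show "p \<in> topspace Y"
    using assms(1) by (simp add: limitin_def)
  fix U assume "p \<in> U \<and> openin Y U"
  then have "eventually (\<lambda>x. e x \<in> U) F"
    using assms(1) by (auto simp: limitin_def)
  moreover have "eventually (\<lambda>x. x \<in> S) F"
    using assms(3) by (simp add: le_principal)
  ultimately have "eventually (\<lambda>x. x \<in> S \<and> e x \<in> U) F"
    by eventually_elim simp
  then show "\<exists>y. y \<in> e ` S \<and> y \<in> U"
    using eventually_happens'[OF assms(2)] by fast
qed

section \<open>Filters on a space and points of its Stone--Cech compactification\<close>

lemma limitin_Some_iff:
  "limitin (Alexandroff_compactification euclideanreal) (Some \<circ> f) (Some t) F \<longleftrightarrow> (f \<longlongrightarrow> t) F"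
proof
  assume lim: "limitin (Alexandroff_compactification euclideanreal) (Some \<circ> f) (Some t) F"
  show "(f \<longlongrightarrow> t) F"
  proof (rule topological_tendstoI)
    fix U :: "real set" assume "open U" "t \<in> U"
    then have "eventually (\<lambda>x. (Some \<circ> f) x \<in> Some ` U) F"
      using lim by (simp add: limitin_def)
    then show "eventually (\<lambda>x. f x \<in> U) F"
      by (rule eventually_mono) auto
  qed
next
  assume "(f \<longlongrightarrow> t) F"
  then show "limitin (Alexandroff_compactification euclideanreal) (Some \<circ> f) (Some t) F"
    by (intro continuous_map_limit[OF continuous_map_Some]) simp
qed

text \<open>Both sides describe the limit of \<open>Some \<circ> f\<close> along \<open>F\<close> in the Hausdorff space
  \<open>\<real> \<union> {\<infinity>}\<close>, the left one because \<open>f\<^sup>\<beta>\<close> is continuous at \<open>p\<close>.\<close>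

lemma stone_cech_ext_eq_Some_iff:
  assumes f: "continuous_map X euclideanreal f"
    and F: "F \<noteq> bot" "F \<le> principal (topspace X)"
    and p: "limitin (stone_cech X) (stone_cech_embed X) p F"
  shows "stone_cech_ext X f p = Some t \<longleftrightarrow> (f \<longlongrightarrow> t) F"
proof -
  let ?A = "Alexandroff_compactification euclideanreal"
  have ext: "continuous_map (stone_cech X) ?A (stone_cech_ext X f)"
    "\<And>x. x \<in> topspace X \<Longrightarrow> stone_cech_ext X f (stone_cech_embed X x) = Some (f x)"
    using is_stone_cech_ext[OF f] by (auto simp: is_stone_cech_ext_def)
  have "eventually (\<lambda>x. x \<in> topspace X) F"
    using F(2) by (simp add: le_principal)
  then have "eventually (\<lambda>x. (stone_cech_ext X f \<circ> stone_cech_embed X) x = (Some \<circ> f) x) F"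
    by eventually_elim (simp add: ext(2))
  then have lim: "limitin ?A (Some \<circ> f) (stone_cech_ext X f p) F"
    using continuous_map_limit[OF ext(1) p] by (rule limitin_transform_eventually)
  have "Hausdorff_space ?A"
    by (simp add: Hausdorff_space_Alexandroff_compactification locally_compact_space_euclidean)
  then have "stone_cech_ext X f p = l" if "limitin ?A (Some \<circ> f) l F" for l
    by (rule limitin_Hausdorff_unique[OF lim that F(1)])
  then have "stone_cech_ext X f p = Some t \<longleftrightarrow> limitin ?A (Some \<circ> f) (Some t) F"
    using lim by metis
  then show ?thesis
    by (simp add: limitin_Some_iff)
qed

text \<open>Convergence in \<open>\<beta>(X)\<close> is coordinatewise, and the coordinates are the continuous maps into
  the unit interval.\<close>

lemma limitin_stone_cech_iff:
  assumes "F \<noteq> bot" "F \<le> principal (topspace X)"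
  shows "limitin (stone_cech X) (stone_cech_embed X) p F \<longleftrightarrow>
    p \<in> extensional (unit_cfuns X) \<and> (\<forall>h\<in>unit_cfuns X. (h \<longlongrightarrow> p h) F)"
proof -
  let ?e = "stone_cech_embed X"
  have inX: "eventually (\<lambda>x. x \<in> topspace X) F"
    using assms(2) by (simp add: le_principal)
  have image: "?e x \<in> topspace (unit_cube X)" if "x \<in> topspace X" for x
    using that continuous_map_image_subset_topspace[OF continuous_map_stone_cech_embed_cube[of X]]
    by (rule image_subset_iff[THEN iffD1, THEN bspec, rotated])
  have "limitin (stone_cech X) ?e p F \<longleftrightarrow> limitin (unit_cube X) ?e p F"
  proof -
    have "eventually (\<lambda>x. ?e x \<in> unit_cube X closure_of (?e ` topspace X)) F"
      by (rule eventually_mono[OF inX]) (use stone_cech_embed_subset_closure[of X] in blast)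
    moreover have "p \<in> unit_cube X closure_of (?e ` topspace X)" if "limitin (unit_cube X) ?e p F"
      by (rule limitin_imp_closure_of[OF that assms])
    ultimately show ?thesis
      unfolding stone_cech_def limitin_subtopology by blast
  qed
  also have "\<dots> \<longleftrightarrow> p \<in> extensional (unit_cfuns X) \<and>
      (\<forall>h\<in>unit_cfuns X. limitin (top_of_set {0..1}) h (p h) F)"
    using eventually_mono[OF inX image]
    by (simp add: unit_cube_def limitin_componentwise stone_cech_embed_def)
  also have "\<dots> \<longleftrightarrow> p \<in> extensional (unit_cfuns X) \<and> (\<forall>h\<in>unit_cfuns X. (h \<longlongrightarrow> p h) F)"
  proof (intro conj_cong refl ball_cong)
    fix h assume h: "h \<in> unit_cfuns X"
    have range: "eventually (\<lambda>x. h x \<in> {0..1}) F"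
      using inX by eventually_elim
        (use h in \<open>auto simp: unit_cfuns_def continuous_map_in_subtopology\<close>)
    have "p h \<in> {0..1}" if "(h \<longlongrightarrow> p h) F"
      by (rule Lim_in_closed_set[OF _ range assms(1) that]) simp
    then show "limitin (top_of_set {0..1}) h (p h) F \<longleftrightarrow> (h \<longlongrightarrow> p h) F"
      using range by (auto simp: limitin_subtopology)
  qed
  finally show ?thesis .
qed

section \<open>Characters as limits along filters\<close>

lemma unit_cfuns_subset_bounded_cfuns:
  assumes "\<B> \<subseteq> Pow (topspace X)"
  shows "unit_cfuns X \<subseteq> bounded_cfuns X \<B>"
proof
  fix h assume "h \<in> unit_cfuns X"
  then have h: "h \<in> extensional (topspace X)" "continuous_map X euclideanreal h"
    "h ` topspace X \<subseteq> {0..1}"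
    by (auto simp: unit_cfuns_def continuous_map_in_subtopology)
  have "bounded (h ` B)" if "B \<in> \<B>" for B
    by (rule bounded_subset[OF bounded_closed_interval[of 0 1]]) (use that h(3) assms in auto)
  then show "h \<in> bounded_cfuns X \<B>"
    using h by (simp add: bounded_cfuns_def)
qed

text \<open>Membership of the constant \<open>1\<close> is what makes the limit functional nonzero.\<close>

lemma limit_along_filter_is_character:
  assumes "F \<noteq> bot" "F \<le> principal S"
    and add: "\<And>f g. f \<in> \<A> \<Longrightarrow> g \<in> \<A> \<Longrightarrow> fun_add S f g \<in> \<A>"
    and mult: "\<And>f g. f \<in> \<A> \<Longrightarrow> g \<in> \<A> \<Longrightarrow> fun_mult S f g \<in> \<A>"
    and scale: "\<And>f c. f \<in> \<A> \<Longrightarrow> fun_scale S c f \<in> \<A>"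
    and one: "(\<lambda>x\<in>S. 1) \<in> \<A>"
    and lim: "\<And>f. f \<in> \<A> \<Longrightarrow> (f \<longlongrightarrow> \<tau> f) F"
  shows "character_on S \<A> \<tau>"
proof -
  have inS: "eventually (\<lambda>x. x \<in> S) F"
    using assms(2) by (simp add: le_principal)
  have limit: "\<tau> (\<lambda>x\<in>S. u x) = l" if "(\<lambda>x\<in>S. u x) \<in> \<A>" "(u \<longlongrightarrow> l) F" for u l
  proof (rule tendsto_unique[OF assms(1)])
    show "((\<lambda>x\<in>S. u x) \<longlongrightarrow> \<tau> (\<lambda>x\<in>S. u x)) F"
      by (rule lim[OF that(1)])
    have "eventually (\<lambda>x. u x = (\<lambda>x\<in>S. u x) x) F"
      using inS by eventually_elim simp
    then show "((\<lambda>x\<in>S. u x) \<longlongrightarrow> l) F"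
      using that(2) by (rule tendsto_cong[THEN iffD1])
  qed
  show ?thesis
    unfolding character_on_def
  proof (intro conjI ballI allI)
    fix f g assume "f \<in> \<A>" "g \<in> \<A>"
    then show "\<tau> (fun_add S f g) = \<tau> f + \<tau> g" "\<tau> (fun_mult S f g) = \<tau> f * \<tau> g"
      using add mult unfolding fun_add_def fun_mult_def by (auto intro!: limit tendsto_intros lim)
  next
    fix c f assume "f \<in> \<A>"
    then show "\<tau> (fun_scale S c f) = c * \<tau> f"
      using scale unfolding fun_scale_def by (auto intro!: limit tendsto_intros lim)
  next
    have "\<tau> (\<lambda>x\<in>S. 1) = 1"
      using one by (intro limit) auto
    then show "\<exists>f\<in>\<A>. \<tau> f \<noteq> 0"
      using one by (intro bexI[of _ "\<lambda>x\<in>S. 1"]) auto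
  qed
qed

lemma character_const:
  assumes \<tau>: "character_on S \<A> \<tau>" and one: "(\<lambda>x\<in>S. 1) \<in> \<A>"
    and ext: "\<A> \<subseteq> extensional S"
  shows "\<tau> (\<lambda>x\<in>S. c) = c"
proof -
  obtain f where f: "f \<in> \<A>" "\<tau> f \<noteq> 0"
    using \<tau> by (auto simp: character_on_def)
  have "fun_mult S f (\<lambda>x\<in>S. 1) = f"
    using f(1) ext by (auto simp: fun_mult_def fun_eq_iff extensional_def)
  then have "\<tau> f = \<tau> f * \<tau> (\<lambda>x\<in>S. 1)"
    using \<tau> f(1) one by (metis character_on_def)
  then have "\<tau> (\<lambda>x\<in>S. 1) = 1"
    using f(2) by simp
  moreover have "fun_scale S c (\<lambda>x\<in>S. 1) = (\<lambda>x\<in>S. c)"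
    by (auto simp: fun_scale_def)
  ultimately show ?thesis
    using \<tau> one by (metis character_on_def mult.right_neutral)
qed

lemma reciprocal_in_bounded_cfuns:
  assumes g: "g \<in> bounded_cfuns X \<B>" and \<B>: "\<B> \<subseteq> Pow (topspace X)"
    and ge: "\<And>x. x \<in> topspace X \<Longrightarrow> 1 \<le> \<bar>g x\<bar>"
  shows "(\<lambda>x\<in>topspace X. inverse (g x)) \<in> bounded_cfuns X \<B>" (is "?h \<in> _")
proof -
  have "continuous_map X euclideanreal (\<lambda>x. inverse (g x))"
    using g ge by (intro continuous_map_real_inverse) (force simp: bounded_cfuns_def)+
  then have "continuous_map X euclideanreal ?h"
    by (rule continuous_map_eq) auto
  moreover have "bounded (?h ` B)" if "B \<in> \<B>" for B
  proof -
    have "\<bar>?h x\<bar> \<le> 1" if "x \<in> B" for x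
      using that \<open>B \<in> \<B>\<close> \<B> ge[of x] by (auto simp: abs_inverse intro!: inverse_le_1_iff[THEN iffD2])
    then show ?thesis
      unfolding bounded_iff by (intro exI[of _ 1]) (simp only: ball_simps real_norm_def, blast)
  qed
  ultimately show ?thesis
    by (simp add: bounded_cfuns_def)
qed

text \<open>Otherwise \<open>g\<close> would be a unit of the algebra, and characters do not vanish on units.\<close>

lemma character_kernel_not_bounded_away:
  assumes \<tau>: "character_on (topspace X) (bounded_cfuns X \<B>) \<tau>"
    and \<B>: "\<B> \<subseteq> Pow (topspace X)"
    and g: "g \<in> bounded_cfuns X \<B>" "\<tau> g = 0"
  shows "\<exists>x\<in>topspace X. \<bar>g x\<bar> < 1"
proof (rule ccontr)
  assume "\<not> ?thesis"
  then have ge: "1 \<le> \<bar>g x\<bar>" if "x \<in> topspace X" for x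
    using that by force
  let ?h = "\<lambda>x\<in>topspace X. inverse (g x)"
  have h: "?h \<in> bounded_cfuns X \<B>"
    by (rule reciprocal_in_bounded_cfuns[OF g(1) \<B> ge])
  have "fun_mult (topspace X) g ?h = (\<lambda>x\<in>topspace X. 1)"
  proof
    fix x show "fun_mult (topspace X) g ?h x = (\<lambda>x\<in>topspace X. 1) x"
      using ge[of x] by (cases "g x = 0") (auto simp: fun_mult_def)
  qed
  then have "\<tau> (\<lambda>x\<in>topspace X. 1) = \<tau> g * \<tau> ?h"
    using \<tau> g(1) h by (metis character_on_def)
  moreover have "\<tau> (\<lambda>x\<in>topspace X. 1) = 1"
    by (rule character_const[OF \<tau> bounded_cfuns_algebra(4)[OF g(1) g(1) \<B>]])
      (auto simp: bounded_cfuns_def)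
  ultimately show False
    using g(2) by simp
qed

lemma character_is_limit_along_filter:
  assumes \<tau>: "character_on (topspace X) (bounded_cfuns X \<B>) \<tau>"
    and \<B>: "\<B> \<subseteq> Pow (topspace X)"
  obtains F where "F \<noteq> bot" "F \<le> principal (topspace X)"
    "\<And>f. f \<in> bounded_cfuns X \<B> \<Longrightarrow> (f \<longlongrightarrow> \<tau> f) F"
proof
  let ?S = "topspace X" and ?A = "bounded_cfuns X \<B>"
  note alg = bounded_cfuns_algebra[OF _ _ \<B>]
  have hom: "\<tau> (fun_add ?S f g) = \<tau> f + \<tau> g" "\<tau> (fun_mult ?S f g) = \<tau> f * \<tau> g"
    "\<tau> (fun_scale ?S c f) = c * \<tau> f" if "f \<in> ?A" "g \<in> ?A" for f g c
    using \<tau> that by (auto simp: character_on_def)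
  define K where "K = {g \<in> ?A. \<tau> g = 0}"
  define D where "D = (\<lambda>g :: 'a \<Rightarrow> real. {x \<in> ?S. \<bar>g x\<bar> < 1})"
  let ?F = "INF g\<in>K. principal (D g)"
  obtain f0 where f0: "f0 \<in> ?A"
    using \<tau> by (auto simp: character_on_def)
  have const: "(\<lambda>x\<in>?S. c) \<in> ?A" "\<tau> (\<lambda>x\<in>?S. c) = c" for c
  proof -
    show mem: "(\<lambda>x\<in>?S. c) \<in> ?A" for c
      by (rule alg(4)[OF f0 f0])
    show "\<tau> (\<lambda>x\<in>?S. c) = c"
      by (rule character_const[OF \<tau> mem]) (auto simp: bounded_cfuns_def)
  qed
  have "K \<noteq> {}"
    using const[of 0] by (auto simp: K_def)
  \<comment> \<open>The sum of squares keeps the kernel sets directed downwards.\<close>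
  moreover have "\<exists>k\<in>K. principal (D k) \<le> inf (principal (D g)) (principal (D h))"
    if "g \<in> K" "h \<in> K" for g h
  proof -
    let ?k = "fun_add ?S (fun_mult ?S g g) (fun_mult ?S h h)"
    have "?k \<in> K"
      using that by (simp add: K_def alg hom)
    moreover have "D ?k \<subseteq> D g \<inter> D h"
    proof
      fix x assume "x \<in> D ?k"
      then have x: "x \<in> ?S" "g x * g x + h x * h x < 1"
        by (auto simp: D_def fun_add_def fun_mult_def)
      then have "(g x)\<^sup>2 < 1" "(h x)\<^sup>2 < 1"
        using zero_le_square[of "g x"] zero_le_square[of "h x"]
        unfolding power2_eq_square by linarith+
      then show "x \<in> D g \<inter> D h"
        using x(1) by (simp add: D_def abs_square_less_1)
    qed
    ultimately show ?thesis
      by auto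
  qed
  ultimately have ev: "eventually P ?F \<longleftrightarrow> (\<exists>g\<in>K. \<forall>x\<in>D g. P x)" for P
    by (simp add: eventually_INF_base eventually_principal)
  show "?F \<noteq> bot"
    unfolding trivial_limit_def ev
    using character_kernel_not_bounded_away[OF \<tau> \<B>] by (fastforce simp: K_def D_def)
  show "?F \<le> principal ?S"
    unfolding le_principal ev using \<open>K \<noteq> {}\<close> by (auto simp: D_def)
  show "(f \<longlongrightarrow> \<tau> f) ?F" if f: "f \<in> ?A" for f
  proof (rule tendstoI)
    fix e :: real assume e: "0 < e"
    \<comment> \<open>This kernel element is \<open>(f - \<tau> f) / e\<close>.\<close>
    let ?g = "fun_scale ?S (1 / e) (fun_add ?S f (\<lambda>x\<in>?S. - \<tau> f))"
    have "?g \<in> K"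
      using f const[of "- \<tau> f"] by (simp add: K_def alg hom)
    moreover have "dist (f x) (\<tau> f) < e" if "x \<in> D ?g" for x
      using that e by (auto simp: D_def fun_scale_def fun_add_def dist_real_def abs_divide field_simps)
    ultimately show "eventually (\<lambda>x. dist (f x) (\<tau> f) < e) ?F"
      unfolding ev by blast
  qed
qed

section \<open>Realcompactness and point evaluations\<close>

theorem proposition17:
  fixes X :: "'a topology" and \<B> :: "'a set set"
  assumes "bornological_universe X \<B>" and "Tychonoff_space X"
  shows "realcompact_universe X \<B> \<longleftrightarrow>
    (\<forall>\<tau>. character_on (topspace X) (bounded_cfuns X \<B>) \<tau> \<longrightarrow>
      (\<exists>x\<in>topspace X. \<forall>f\<in>bounded_cfuns X \<B>. \<tau> f = f x))"
proof -
  let ?S = "topspace X" and ?A = "bounded_cfuns X \<B>" and ?e = "stone_cech_embed X"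
  have \<B>: "\<B> \<subseteq> Pow ?S"
    using assms(1) by (simp add: bornological_universe_def bornology_on_def)
  note alg = bounded_cfuns_algebra[OF _ _ \<B>]
  note unit = subsetD[OF unit_cfuns_subset_bounded_cfuns[OF \<B>]]
  have cont: "continuous_map X euclideanreal f" if "f \<in> ?A" for f
    using that by (simp add: bounded_cfuns_def)
  have ext_embed: "stone_cech_ext X f (?e x) = Some (f x)" if "f \<in> ?A" "x \<in> ?S" for f x
    using is_stone_cech_ext[OF cont[OF that(1)]] that(2) by (simp add: is_stone_cech_ext_def)
  show ?thesis
  proof
    assume rc: "realcompact_universe X \<B>"
    show "\<forall>\<tau>. character_on ?S ?A \<tau> \<longrightarrow> (\<exists>x\<in>?S. \<forall>f\<in>?A. \<tau> f = f x)"
    proof (intro allI impI)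
      fix \<tau> assume "character_on ?S ?A \<tau>"
      then obtain F where F: "F \<noteq> bot" "F \<le> principal ?S" "\<And>f. f \<in> ?A \<Longrightarrow> (f \<longlongrightarrow> \<tau> f) F"
        using character_is_limit_along_filter \<B> by metis
      \<comment> \<open>The coordinates of the limit of \<open>F\<close> in \<open>\<beta>(X)\<close> are the values of \<open>\<tau>\<close> itself.\<close>
      define p where "p = restrict \<tau> (unit_cfuns X)"
      have lim: "limitin (stone_cech X) ?e p F"
        using F(3) unit by (simp add: limitin_stone_cech_iff[OF F(1,2)] p_def)
      have ext: "stone_cech_ext X f p = Some (\<tau> f)" if "f \<in> ?A" for f
        using stone_cech_ext_eq_Some_iff[OF cont[OF that] F(1,2) lim] F(3)[OF that] by simp
      have "p \<in> realcompactification X \<B>"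
        using lim ext by (auto simp: realcompactification_def limitin_def)
      then obtain x where "x \<in> ?S" "p = ?e x"
        using rc by (auto simp: realcompact_universe_def)
      then show "\<exists>x\<in>?S. \<forall>f\<in>?A. \<tau> f = f x"
        using ext ext_embed by auto
    qed
  next
    assume eval: "\<forall>\<tau>. character_on ?S ?A \<tau> \<longrightarrow> (\<exists>x\<in>?S. \<forall>f\<in>?A. \<tau> f = f x)"
    show "realcompact_universe X \<B>"
      unfolding realcompact_universe_def
    proof (intro equalityI subsetI)
      fix p assume p: "p \<in> realcompactification X \<B>"
      then have "p \<in> stone_cech X closure_of (?e ` ?S)"
        by (simp add: stone_cech_dense realcompactification_def)
      then obtain F where F: "F \<noteq> bot" "F \<le> principal ?S" and lim: "limitin (stone_cech X) ?e p F"
        by (rule closure_of_image_imp_limitin)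
      have coord: "p \<in> extensional (unit_cfuns X)" "\<And>h. h \<in> unit_cfuns X \<Longrightarrow> (h \<longlongrightarrow> p h) F"
        using lim by (auto simp: limitin_stone_cech_iff[OF F])
      define \<tau> where "\<tau> = (\<lambda>f. the (stone_cech_ext X f p))"
      have \<tau>: "(f \<longlongrightarrow> \<tau> f) F" if "f \<in> ?A" for f
      proof -
        obtain t where t: "stone_cech_ext X f p = Some t"
          using p \<open>f \<in> ?A\<close> by (auto simp: realcompactification_def)
        then have "(f \<longlongrightarrow> t) F"
          by (rule stone_cech_ext_eq_Some_iff[OF cont[OF that] F lim, THEN iffD1])
        then show ?thesis
          by (simp add: \<tau>_def t)
      qed
      have "character_on ?S ?A \<tau>"
      proof (rule limit_along_filter_is_character[OF F])
        show "(\<lambda>x\<in>?S. 1) \<in> ?A"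
        proof (rule unit)
          have "continuous_map X (top_of_set {0..1}) (\<lambda>x\<in>?S. 1 :: real)"
            by (rule continuous_map_eq[of _ _ "\<lambda>_. 1"]) auto
          then show "(\<lambda>x\<in>?S. 1) \<in> unit_cfuns X"
            by (simp add: unit_cfuns_def)
        qed
      qed (rule alg \<tau>; assumption)+
      then obtain x where x: "x \<in> ?S" "\<And>f. f \<in> ?A \<Longrightarrow> \<tau> f = f x"
        using eval by blast
      have "p h = h x" if "h \<in> unit_cfuns X" for h
        using tendsto_unique[OF F(1) coord(2)[OF that] \<tau>[OF unit[OF that]]] x(2)[OF unit[OF that]]
        by simp
      then have "p = ?e x"
        using coord(1) by (auto simp: stone_cech_embed_def fun_eq_iff extensional_def)
      then show "p \<in> ?e ` ?S"
        using x(1) by simp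
    next
      fix p assume "p \<in> ?e ` ?S"
      then show "p \<in> realcompactification X \<B>"
        using stone_cech_embed_subset_closure[of X] ext_embed
        by (auto simp: realcompactification_def topspace_stone_cech)
    qed
  qed
qed

end
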